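(* Let $d\ge2$ and let $H$ be a Reproducing Kernel Hilbert Space of functions $\mathbb{R}^d\to\mathbb{R}^d$ with a translation-invariant reproducing kernel, i.e. $K(x,y)=\mathbf{k}(x-y)$ for all $x,y\in\mathbb{R}^d$, with $\mathbf{k}:\mathbb{R}^d\to\mathbb{R}^{d\times d}$. The map $v\mapsto R\,v(R^{-1}\,\cdot\,)$ (that is, $v\mapsto\rho\, v\circ\rho^{-1}$ where $\rho:x\mapsto Rx$) is an isometry in $H$ for every $R\in O(\mathbb{R}^d)$ if and only if $$\mathbf{k}(Rx)=R\,\mathbf{k}(x)R^{-1}\qquad\text{for all }x\in\mathbb{R}^d\text{ and all }R\in O(\mathbb{R}^d).$$
   Context: A Hilbert space $H$ of functions $\mathbb{R}^d\to\mathbb{R}^d$ is a Reproducing Kernel Hilbert Space if for all $x,\alpha\in\mathbb{R}^d$ the functional $u\mapsto\alpha\cdot u(x)$ is continuous on $H$. Its reproducing kernel is the unique $K:\mathbb{R}^d\times\mathbb{R}^d\to\mathbb{R}^{d\times d}$ such that $K(\cdot,x)\alpha\in H$ and $\langle K(\cdot,x)\alpha,u\rangle_H=\alpha\cdot u(x)$ for all $u\in H$ and $x,\alpha\in\mathbb{R}^d$. $O(\mathbb{R}^d)$ is the full orthogonal group. "The map is an isometry in $H$" means that it maps $H$ into $H$ and preserves the inner product. *)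

theory Defs
  imports "HOL-Analysis.Analysis"
begin

text \<open>The vector-space operations are the pointwise ones; nothing is assumed about \<open>ip\<close> outside \<open>H\<close>.\<close>

locale inner_product_function_space =
  fixes H :: "('a \<Rightarrow> 'b::real_vector) set"
    and ip :: "('a \<Rightarrow> 'b) \<Rightarrow> ('a \<Rightarrow> 'b) \<Rightarrow> real"
  assumes zero_mem: "(\<lambda>x. 0) \<in> H"
    and add_mem: "\<lbrakk>u \<in> H; v \<in> H\<rbrakk> \<Longrightarrow> (\<lambda>x. u x + v x) \<in> H"
    and scale_mem: "u \<in> H \<Longrightarrow> (\<lambda>x. c *\<^sub>R u x) \<in> H"
    and ip_commute: "\<lbrakk>u \<in> H; v \<in> H\<rbrakk> \<Longrightarrow> ip u v = ip v u"
    and ip_add_left: "\<lbrakk>u \<in> H; v \<in> H; w \<in> H\<rbrakk> \<Longrightarrow> ip (\<lambda>x. u x + v x) w = ip u w + ip v w"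
    and ip_scale_left: "\<lbrakk>u \<in> H; v \<in> H\<rbrakk> \<Longrightarrow> ip (\<lambda>x. c *\<^sub>R u x) v = c * ip u v"
    and ip_nonneg: "u \<in> H \<Longrightarrow> 0 \<le> ip u u"
    and ip_definite: "\<lbrakk>u \<in> H; ip u u = 0\<rbrakk> \<Longrightarrow> u = (\<lambda>x. 0)"

text \<open>The distance is set to \<open>0\<close> outside \<open>H\<close> because \<^locale>\<open>Metric_space\<close> requires
  non-negativity and symmetry on the whole type.\<close>

definition ip_dist ::
    "('a \<Rightarrow> 'b::real_vector) set \<Rightarrow> (('a \<Rightarrow> 'b) \<Rightarrow> ('a \<Rightarrow> 'b) \<Rightarrow> real) \<Rightarrow> ('a \<Rightarrow> 'b) \<Rightarrow> ('a \<Rightarrow> 'b) \<Rightarrow> real"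
  where "ip_dist H ip u v =
    (if u \<in> H \<and> v \<in> H then sqrt (ip (\<lambda>x. u x - v x) (\<lambda>x. u x - v x)) else 0)"

locale hilbert_function_space = inner_product_function_space +
  assumes complete: "Metric_space.mcomplete H (ip_dist H ip)"

locale rkhs = hilbert_function_space H ip
  for H :: "(real^'n \<Rightarrow> real^'n) set" and ip +
  assumes continuous_eval:
    "continuous_map (Metric_space.mtopology H (ip_dist H ip)) euclideanreal (\<lambda>u. \<alpha> \<bullet> u x)"

definition reproducing_kernel ::
    "(real^'n \<Rightarrow> real^'n) set \<Rightarrow> ((real^'n \<Rightarrow> real^'n) \<Rightarrow> (real^'n \<Rightarrow> real^'n) \<Rightarrow> real)
      \<Rightarrow> (real^'n \<Rightarrow> real^'n \<Rightarrow> real^'n^'n) \<Rightarrow> bool"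
  where "reproducing_kernel H ip K \<longleftrightarrow>
    (\<forall>x \<alpha>. (\<lambda>y. K y x *v \<alpha>) \<in> H \<and> (\<forall>u\<in>H. ip (\<lambda>y. K y x *v \<alpha>) u = \<alpha> \<bullet> u x))"

definition isometry_in ::
    "('a \<Rightarrow> 'b) set \<Rightarrow> (('a \<Rightarrow> 'b) \<Rightarrow> ('a \<Rightarrow> 'b) \<Rightarrow> real) \<Rightarrow> (('a \<Rightarrow> 'b) \<Rightarrow> ('a \<Rightarrow> 'b)) \<Rightarrow> bool"
  where "isometry_in H ip T \<longleftrightarrow>
    (\<forall>u\<in>H. T u \<in> H) \<and> (\<forall>u\<in>H. \<forall>v\<in>H. ip (T u) (T v) = ip u v)"

context inner_product_function_space
begin

lemma diff_mem: "\<lbrakk>u \<in> H; v \<in> H\<rbrakk> \<Longrightarrow> (\<lambda>x. u x - v x) \<in> H"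
  using add_mem[of u "\<lambda>x. (-1) *\<^sub>R v x"] scale_mem[of v "-1"] by simp

lemma ip_add_right: "\<lbrakk>u \<in> H; v \<in> H; w \<in> H\<rbrakk> \<Longrightarrow> ip w (\<lambda>x. u x + v x) = ip w u + ip w v"
  by (simp add: ip_commute[of w] add_mem ip_add_left)

lemma ip_scale_right: "\<lbrakk>u \<in> H; v \<in> H\<rbrakk> \<Longrightarrow> ip v (\<lambda>x. c *\<^sub>R u x) = c * ip v u"
  by (simp add: ip_commute[of v] scale_mem ip_scale_left)

lemma ip_diff_left: "\<lbrakk>u \<in> H; v \<in> H; w \<in> H\<rbrakk> \<Longrightarrow> ip (\<lambda>x. u x - v x) w = ip u w - ip v w"
  using ip_add_left[of u "\<lambda>x. (-1) *\<^sub>R v x" w] scale_mem[of v "-1"] ip_scale_left[of v w "-1"] by simp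

lemma ip_expand:
  assumes "u \<in> H" "v \<in> H"
  shows "ip (\<lambda>x. u x + c *\<^sub>R v x) (\<lambda>x. u x + c *\<^sub>R v x) = ip u u + 2 * c * ip u v + c\<^sup>2 * ip v v"
  using assms
  by (simp add: ip_add_left ip_add_right ip_scale_left ip_scale_right add_mem scale_mem
      ip_commute[of v u] power2_eq_square algebra_simps)

lemma ip_Cauchy_Schwarz:
  assumes "u \<in> H" "v \<in> H"
  shows "ip u v \<le> sqrt (ip u u) * sqrt (ip v v)"
proof (cases "ip v v = 0")
  case True
  then have "v = (\<lambda>x. 0)" using ip_definite assms by blast
  then have "ip u v = 0" using ip_scale_right[of v u 0] assms by simp
  then show ?thesis using True by simp
next
  case False
  then have pos: "ip v v > 0" using ip_nonneg[OF assms(2)] by simp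
  have "0 \<le> ip u u + 2 * (- ip u v / ip v v) * ip u v + (- ip u v / ip v v)\<^sup>2 * ip v v"
    using ip_nonneg[OF add_mem[OF assms(1) scale_mem[OF assms(2)]]] ip_expand[OF assms] by metis
  then have "(ip u v)\<^sup>2 \<le> ip u u * ip v v"
    using pos by (simp add: field_simps power2_eq_square)
  then show ?thesis
    by (metis real_le_rsqrt real_sqrt_mult)
qed

lemma Metric_space_ip_dist: "Metric_space H (ip_dist H ip)"
proof
  fix u v w
  show "0 \<le> ip_dist H ip u v"
    by (simp add: ip_dist_def ip_nonneg diff_mem)
  show "ip_dist H ip u v = ip_dist H ip v u"
  proof (cases "u \<in> H \<and> v \<in> H")
    case True
    let ?d = "\<lambda>x. u x - v x"
    have "?d \<in> H" using True diff_mem by simp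
    then have "ip (\<lambda>x. (-1) *\<^sub>R ?d x) (\<lambda>x. (-1) *\<^sub>R ?d x) = ip ?d ?d"
      using ip_scale_left[of ?d "\<lambda>x. (-1) *\<^sub>R ?d x" "-1"] ip_scale_right[of ?d ?d "-1"]
        scale_mem[of ?d "-1"] by simp
    then show ?thesis using True by (simp add: ip_dist_def)
  qed (auto simp: ip_dist_def)
  assume u: "u \<in> H" and v: "v \<in> H"
  show "ip_dist H ip u v = 0 \<longleftrightarrow> u = v"
  proof
    assume "ip_dist H ip u v = 0"
    then have "(\<lambda>x. u x - v x) = (\<lambda>x. 0)"
      using u v ip_definite diff_mem by (simp add: ip_dist_def)
    then show "u = v" by (metis eq_iff_diff_eq_0 ext)
  next
    assume "u = v"
    then show "ip_dist H ip u v = 0"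
      using u ip_scale_left[of u "\<lambda>x. 0" 0] zero_mem by (simp add: ip_dist_def)
  qed
  assume w: "w \<in> H"
  let ?a = "\<lambda>x. u x - v x" and ?b = "\<lambda>x. v x - w x"
  have ab: "?a \<in> H" "?b \<in> H" using u v w diff_mem by auto
  have "ip (\<lambda>x. u x - w x) (\<lambda>x. u x - w x) = ip ?a ?a + 2 * ip ?a ?b + ip ?b ?b"
    using ip_expand[OF ab, of 1] by simp
  also have "\<dots> \<le> (sqrt (ip ?a ?a) + sqrt (ip ?b ?b))\<^sup>2"
    using ip_Cauchy_Schwarz[OF ab] ip_nonneg[OF ab(1)] ip_nonneg[OF ab(2)]
    by (simp add: power2_sum)
  finally have "sqrt (ip (\<lambda>x. u x - w x) (\<lambda>x. u x - w x)) \<le> sqrt (ip ?a ?a) + sqrt (ip ?b ?b)"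
    using ip_nonneg[OF ab(1)] ip_nonneg[OF ab(2)] by (simp add: real_le_lsqrt)
  then show "ip_dist H ip u w \<le> ip_dist H ip u v + ip_dist H ip v w"
    using u v w by (simp add: ip_dist_def)
qed

end

lemma reproducing_kernel_unique:
  assumes "inner_product_function_space H ip"
    and K: "reproducing_kernel H ip K" and K': "reproducing_kernel H ip K'"
  shows "K = K'"
proof (intro ext)
  fix y x
  interpret inner_product_function_space H ip by fact
  have "K y x *v \<alpha> = K' y x *v \<alpha>" for \<alpha>
  proof -
    let ?u = "\<lambda>y. K y x *v \<alpha>" and ?v = "\<lambda>y. K' y x *v \<alpha>"
    have uv: "?u \<in> H" "?v \<in> H" using K K' by (auto simp: reproducing_kernel_def)
    let ?d = "\<lambda>y. ?u y - ?v y"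
    have d: "?d \<in> H" using diff_mem[OF uv] .
    have "ip ?d ?d = ip ?u ?d - ip ?v ?d" using ip_diff_left[OF uv d] .
    also have "ip ?u ?d = \<alpha> \<bullet> ?d x" using K d unfolding reproducing_kernel_def by blast
    also have "ip ?v ?d = \<alpha> \<bullet> ?d x" using K' d unfolding reproducing_kernel_def by blast
    finally have "?d = (\<lambda>x. 0)" using ip_definite[OF d] by simp
    then show ?thesis by (metis eq_iff_diff_eq_0)
  qed
  then show "K y x = K' y x" by (simp add: matrix_eq)
qed

end

theory Submission
  imports Defs
begin

text \<open>Conjugation by \<open>R\<close> turns the kernel \<open>K\<close> into \<open>R K(R\<^sup>-\<^sup>1 y, R\<^sup>-\<^sup>1 x) R\<^sup>-\<^sup>1\<close>.  If all conjugations are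
  isometries, this is again a reproducing kernel, so it equals \<open>K\<close> by uniqueness.  Conversely, if
  \<open>k\<close> is equivariant, conjugation permutes the kernel sections and preserves their inner products.
  The sections span a dense subspace, and the isometry extends to \<open>H\<close> by completeness; the extension
  is again the conjugation because convergence in \<open>H\<close> implies pointwise convergence.\<close>

section \<open>Orthogonal matrices\<close>

lemma matrix_inv_orthogonal:
  fixes R :: "real^'n^'n"
  assumes "orthogonal_matrix R"
  shows "matrix_inv R = transpose R"
proof -
  have "R ** matrix_inv R = mat 1 \<and> matrix_inv R ** R = mat 1"
    using assms unfolding matrix_inv_def orthogonal_matrix_def by (metis (mono_tags, lifting) someI_ex)
  then show ?thesis
    using assms unfolding orthogonal_matrix_def by (metis matrix_mul_assoc matrix_mul_lid matrix_mul_rid)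
qed

lemma inner_matrix_vector_mult:
  fixes R :: "real^'n^'m"
  shows "\<alpha> \<bullet> (R *v y) = (transpose R *v \<alpha>) \<bullet> y"
  by (simp add: dot_lmul_matrix)

text \<open>As a simp rule this turns \<open>transpose R *v x\<close> into \<open>x v* R\<close>, a
  form that the cancellation rules for orthogonal matrices do not match.\<close>

declare transpose_matrix_vector [simp del]

lemma isometry_inD:
  assumes "isometry_in H ip T" "u \<in> H"
  shows "T u \<in> H" "v \<in> H \<Longrightarrow> ip (T u) (T v) = ip u v"
  using assms by (auto simp: isometry_in_def)

lemma orthogonal_matrix_cancel:
  fixes R :: "real^'n^'n"
  assumes "orthogonal_matrix R"
  shows "R *v (transpose R *v x) = x" "transpose R *v (R *v x) = x"
  using assms by (simp_all add: orthogonal_matrix_def matrix_vector_mul_assoc)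

section \<open>Continuity of the inner product\<close>

context inner_product_function_space
begin

lemma ip_dist_sq:
  assumes "u \<in> H" "v \<in> H"
  shows "(ip_dist H ip u v)\<^sup>2 = ip (\<lambda>x. u x - v x) (\<lambda>x. u x - v x)"
  using assms by (simp add: ip_dist_def ip_nonneg diff_mem)

lemma ip_diff_right: "\<lbrakk>u \<in> H; v \<in> H; w \<in> H\<rbrakk> \<Longrightarrow> ip w (\<lambda>x. u x - v x) = ip w u - ip w v"
  by (simp add: ip_commute[of w] diff_mem ip_diff_left)

text \<open>\<open>ip_Cauchy_Schwarz\<close> is one-sided; applying it to \<open>-u\<close> as well
  gives the absolute value.\<close>

lemma abs_ip_le:
  assumes "u \<in> H" "v \<in> H"
  shows "\<bar>ip u v\<bar> \<le> sqrt (ip u u) * sqrt (ip v v)"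
proof -
  let ?m = "\<lambda>x. (-1) *\<^sub>R u x"
  have m: "?m \<in> H" using assms scale_mem by blast
  have "ip ?m v = - ip u v" "ip ?m ?m = ip u u"
    using assms m ip_scale_left[of u v "-1"] ip_scale_left[of u ?m "-1"] ip_scale_right[of u u "-1"]
    by simp_all
  then show ?thesis
    using ip_Cauchy_Schwarz[OF assms] ip_Cauchy_Schwarz[OF m assms(2)] by simp
qed

text \<open>By Cauchy-Schwarz the error is at most the distance from \<open>h n\<close> to
  \<open>f\<close> times the norm of \<open>g\<close>.\<close>

lemma tendsto_ip_left:
  assumes h: "\<And>n::nat. h n \<in> H" and f: "f \<in> H" and g: "g \<in> H"
    and lim: "(\<lambda>n. ip_dist H ip (h n) f) \<longlonglongrightarrow> 0"
  shows "(\<lambda>n. ip (h n) g) \<longlonglongrightarrow> ip f g"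
proof -
  have bound: "\<bar>ip (h n) g - ip f g\<bar> \<le> ip_dist H ip (h n) f * sqrt (ip g g)" for n
    using abs_ip_le[OF diff_mem[OF h f] g] h f g by (simp add: ip_diff_left ip_dist_def)
  have "(\<lambda>n. ip_dist H ip (h n) f * sqrt (ip g g)) \<longlonglongrightarrow> 0"
    using tendsto_mult_left_zero[OF lim] .
  then have "(\<lambda>n. ip (h n) g - ip f g) \<longlonglongrightarrow> 0"
    by (rule Lim_null_comparison[rotated]) (simp add: bound)
  then show ?thesis by (simp add: LIM_zero_iff)
qed

text \<open>The parallelogram law is written with the midpoint because the midpoint of two
  approximants stays in a subspace, where the infimum bounds it from below.\<close>

lemma ip_parallelogram:
  assumes "u \<in> H" "v \<in> H"
  shows "ip (\<lambda>x. u x - v x) (\<lambda>x. u x - v x) = 2 * ip u u + 2 * ip v v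
    - 4 * ip (\<lambda>x. (1/2) *\<^sub>R (u x + v x)) (\<lambda>x. (1/2) *\<^sub>R (u x + v x))"
  using assms
  by (simp add: ip_add_left ip_add_right ip_diff_left ip_diff_right ip_scale_left ip_scale_right
      add_mem diff_mem scale_mem ip_commute[of v u] field_simps)

end

section \<open>Density of total subspaces\<close>

context hilbert_function_space
begin

lemma ip_dist_Cauchy_convergent:
  assumes h: "\<And>n::nat. h n \<in> H"
    and Cauchy: "\<And>e. e > 0 \<Longrightarrow> \<exists>N. \<forall>m\<ge>N. \<forall>n\<ge>N. ip_dist H ip (h m) (h n) < e"
  obtains w where "w \<in> H" "(\<lambda>n. ip_dist H ip (h n) w) \<longlonglongrightarrow> 0"
proof -
  interpret M: Metric_space H "ip_dist H ip" by (rule Metric_space_ip_dist)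
  have "M.MCauchy h"
    using h Cauchy unfolding M.MCauchy_def by auto
  then obtain w where "limitin M.mtopology h w sequentially"
    using complete unfolding M.mcomplete_def by blast
  then show ?thesis
    using that by (auto simp: M.limitin_metric_dist_null)
qed

text \<open>A minimising sequence for the distance from \<open>v\<close> to \<open>S\<close> is Cauchy; its limit \<open>w\<close> is the
  orthogonal projection of \<open>v\<close>, so \<open>v - w\<close> is orthogonal to \<open>S\<close> and vanishes.\<close>

lemma total_subspace_dense:
  assumes S: "S \<subseteq> H" "S \<noteq> {}"
    and add: "\<And>f g. \<lbrakk>f \<in> S; g \<in> S\<rbrakk> \<Longrightarrow> (\<lambda>x. f x + g x) \<in> S"
    and scale: "\<And>c f. f \<in> S \<Longrightarrow> (\<lambda>x. c *\<^sub>R f x) \<in> S"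
    and total: "\<And>u. \<lbrakk>u \<in> H; \<And>s. s \<in> S \<Longrightarrow> ip s u = 0\<rbrakk> \<Longrightarrow> u = (\<lambda>x. 0)"
    and v: "v \<in> H"
  shows "\<exists>h. (\<forall>n. h n \<in> S) \<and> (\<lambda>n. ip_dist H ip (h n) v) \<longlonglongrightarrow> 0"
proof -
  \<comment> \<open>\<open>q\<close> is the squared norm and \<open>D\<close> below the squared
    distance from \<open>v\<close> to \<open>S\<close>; squares let the parallelogram law apply
    without roots.\<close>
  define q where "q u = ip u u" for u
  define A where "A = (\<lambda>s. q (\<lambda>x. v x - s x)) ` S"
  define D where "D = Inf A"
  have bdd: "bdd_below A"
    unfolding A_def q_def using S(1) v by (auto intro!: bdd_belowI2[where m=0] ip_nonneg diff_mem)
  have D_le: "D \<le> q (\<lambda>x. v x - s x)" if "s \<in> S" for s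
    unfolding D_def using bdd that by (auto simp: A_def intro: cInf_lower)
  have "\<exists>s\<in>S. q (\<lambda>x. v x - s x) < D + inverse (Suc n)" for n
    using cInf_lessD[of A "D + inverse (Suc n)"] S(2) by (auto simp: D_def A_def)
  then obtain h where hS: "\<And>n. h n \<in> S"
    and h_lt: "\<And>n. q (\<lambda>x. v x - h n x) < D + inverse (Suc n)" by metis
  have hH: "h n \<in> H" for n using hS S(1) by blast
  \<comment> \<open>The midpoint \<open>?s\<close> lies in \<open>S\<close>, so its term in the
    parallelogram law contributes at most \<open>- 4 * D\<close>; this cancels the \<open>D\<close>
    in the bounds for \<open>?a\<close> and \<open>?b\<close>.\<close>
  have mid: "(ip_dist H ip (h m) (h n))\<^sup>2 \<le> 2 * inverse (Suc m) + 2 * inverse (Suc n)" for m n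
  proof -
    let ?a = "\<lambda>x. v x - h m x" and ?b = "\<lambda>x. v x - h n x"
    let ?s = "\<lambda>x. (1/2) *\<^sub>R (h m x + h n x)"
    have ab: "?a \<in> H" "?b \<in> H" using hH v diff_mem by auto
    have "(\<lambda>x. (1/2) *\<^sub>R (?a x + ?b x)) = (\<lambda>x. v x - ?s x)"
    proof
      fix x
      have "(1/2) *\<^sub>R (?a x + ?b x) = (1/2) *\<^sub>R (2 *\<^sub>R v x) - ?s x"
        by (simp add: scaleR_2 algebra_simps del: scaleR_scaleR)
      then show "(1/2) *\<^sub>R (?a x + ?b x) = v x - ?s x" by simp
    qed
    then have "q (\<lambda>x. ?a x - ?b x) = 2 * q ?a + 2 * q ?b - 4 * q (\<lambda>x. v x - ?s x)"
      using ip_parallelogram[OF ab] by (simp add: q_def)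
    moreover have "D \<le> q (\<lambda>x. v x - ?s x)" using D_le scale add hS by blast
    ultimately have "q (\<lambda>x. ?a x - ?b x) \<le> 2 * inverse (Suc m) + 2 * inverse (Suc n)"
      using h_lt[of m] h_lt[of n] by linarith
    moreover have "(\<lambda>x. ?a x - ?b x) = (\<lambda>x. h n x - h m x)" by auto
    moreover have "ip_dist H ip (h m) (h n) = ip_dist H ip (h n) (h m)"
      using Metric_space.commute[OF Metric_space_ip_dist] .
    ultimately show ?thesis using ip_dist_sq[OF hH hH, of n m] by (simp add: q_def)
  qed
  obtain w where w: "w \<in> H" and lim: "(\<lambda>n. ip_dist H ip (h n) w) \<longlonglongrightarrow> 0"
  proof (rule ip_dist_Cauchy_convergent[OF hH])
    fix e :: real assume e: "e > 0"
    \<comment> \<open>For \<open>m\<close> and \<open>n\<close> beyond \<open>N\<close>,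
      \<open>mid\<close> is at most four times \<open>inverse (Suc N)\<close>, hence the
      \<open>e\<^sup>2 / 4\<close>.\<close>
    then obtain N where N: "inverse (real (Suc N)) < e\<^sup>2 / 4"
      using reals_Archimedean[of "e\<^sup>2 / 4"] by auto
    have "ip_dist H ip (h m) (h n) < e" if "m \<ge> N" "n \<ge> N" for m n
    proof -
      have "inverse (real (Suc m)) \<le> inverse (real (Suc N))"
        "inverse (real (Suc n)) \<le> inverse (real (Suc N))"
        using that by (simp_all add: le_imp_inverse_le)
      then have "(ip_dist H ip (h m) (h n))\<^sup>2 < e\<^sup>2" using mid[of m n] N by linarith
      then show ?thesis using e by (simp add: power_less_imp_less_base)
    qed
    then show "\<exists>N. \<forall>m\<ge>N. \<forall>n\<ge>N. ip_dist H ip (h m) (h n) < e" by blast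
  qed
  have "ip s (\<lambda>x. v x - w x) = 0" if s: "s \<in> S" for s
  proof -
    have sH: "s \<in> H" using s S(1) by blast
    let ?i = "ip (\<lambda>x. v x - w x) s"
    have d: "(\<lambda>x. v x - h n x) \<in> H" for n using diff_mem[OF v hH] .
    have "(\<lambda>n. ip v s - ip (h n) s) \<longlonglongrightarrow> ip v s - ip w s"
      by (intro tendsto_intros tendsto_ip_left hH w sH lim)
    then have lim_i: "(\<lambda>n. ip (\<lambda>x. v x - h n x) s) \<longlonglongrightarrow> ?i"
      by (simp add: ip_diff_left v hH w sH)
    \<comment> \<open>Moving from \<open>h n\<close> to \<open>h n + c s\<close> stays in
      \<open>S\<close> and so cannot bring the squared distance below \<open>D\<close>; as
      \<open>h n\<close> is nearly minimal, the error \<open>inverse (Suc n)\<close> vanishes in the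
      limit.\<close>
    have "2 * c * ?i \<le> c\<^sup>2 * q s" for c
    proof -
      have "2 * c * ip (\<lambda>x. v x - h n x) s \<le> inverse (Suc n) + c\<^sup>2 * q s" for n
      proof -
        have "(\<lambda>x. v x - (h n x + c *\<^sub>R s x)) = (\<lambda>x. (v x - h n x) + (- c) *\<^sub>R s x)" by auto
        then have "D \<le> q (\<lambda>x. (v x - h n x) + (- c) *\<^sub>R s x)"
          using D_le[OF add[OF hS[of n] scale[OF s, of c]]] by simp
        also have "\<dots> = q (\<lambda>x. v x - h n x) - 2 * c * ip (\<lambda>x. v x - h n x) s + c\<^sup>2 * q s"
          unfolding q_def using ip_expand[OF d sH, of n "- c"] by simp
        finally show ?thesis using h_lt[of n] by linarith
      qed
      moreover have "(\<lambda>n. inverse (real (Suc n)) + c\<^sup>2 * q s) \<longlonglongrightarrow> 0 + c\<^sup>2 * q s"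
        by (intro tendsto_intros LIMSEQ_inverse_real_of_nat)
      moreover have "(\<lambda>n. 2 * c * ip (\<lambda>x. v x - h n x) s) \<longlonglongrightarrow> 2 * c * ?i"
        by (intro tendsto_intros lim_i)
      ultimately show ?thesis using LIMSEQ_le[of _ "2 * c * ?i" _ "c\<^sup>2 * q s"] by auto
    qed
    then have ineq: "2 * c * ?i \<le> c\<^sup>2 * q s" for c .
    have "q s \<ge> 0" unfolding q_def using ip_nonneg sH .
    have "?i = 0"
    proof (rule ccontr)
      assume "?i \<noteq> 0"
      \<comment> \<open>The added \<open>1\<close> keeps the denominator positive when
        \<open>q s = 0\<close>; cancelling \<open>c\<^sup>2\<close> in \<open>ineq\<close> then
        leaves an impossible inequality.\<close>
      define c where "c = ?i / (q s + 1)"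
      have i: "?i = c * (q s + 1)" using \<open>q s \<ge> 0\<close> by (simp add: c_def)
      then have "c\<^sup>2 > 0" using \<open>?i \<noteq> 0\<close> by auto
      moreover have "c\<^sup>2 * (2 * (q s + 1)) \<le> c\<^sup>2 * q s"
        using ineq[of c] unfolding i by (simp add: power2_eq_square algebra_simps)
      ultimately have "2 * (q s + 1) \<le> q s" by simp
      then show False using \<open>q s \<ge> 0\<close> by simp
    qed
    then show ?thesis using ip_commute[OF sH diff_mem[OF v w]] by simp
  qed
  then have "(\<lambda>x. v x - w x) = (\<lambda>x. 0)" using total diff_mem[OF v w] by blast
  then have "w = v" by (metis eq_iff_diff_eq_0 ext)
  then show ?thesis using hS lim by blast
qed

end

section \<open>The span of the kernel sections\<close>

text \<open>The linear span of the kernel sections, generated inductively so that claims about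
  linear maps follow by rule induction.\<close>

inductive_set kernel_span :: "(real^'n \<Rightarrow> real^'n \<Rightarrow> real^'n^'n) \<Rightarrow> (real^'n \<Rightarrow> real^'n) set"
  for K where
    kernel_section: "(\<lambda>y. K y x *v \<alpha>) \<in> kernel_span K"
  | add: "\<lbrakk>f \<in> kernel_span K; g \<in> kernel_span K\<rbrakk> \<Longrightarrow> (\<lambda>y. f y + g y) \<in> kernel_span K"
  | scale: "f \<in> kernel_span K \<Longrightarrow> (\<lambda>y. c *\<^sub>R f y) \<in> kernel_span K"

context rkhs
begin

lemma kernel_span_subset:
  assumes "reproducing_kernel H ip K" "f \<in> kernel_span K"
  shows "f \<in> H"
  using assms(2)
  by induction (use assms(1) in \<open>auto simp: reproducing_kernel_def intro: add_mem scale_mem\<close>)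

text \<open>The span is total: a function \<open>u\<close> orthogonal to the section at
  \<open>x\<close> in direction \<open>u x\<close> satisfies
  \<open>u x \<bullet> u x = 0\<close>.\<close>

lemma kernel_span_dense:
  assumes K: "reproducing_kernel H ip K" and v: "v \<in> H"
  shows "\<exists>h. (\<forall>n. h n \<in> kernel_span K) \<and> (\<lambda>n. ip_dist H ip (h n) v) \<longlonglongrightarrow> 0"
proof (rule total_subspace_dense[of "kernel_span K"])
  fix u assume u: "u \<in> H" and orth: "\<And>s. s \<in> kernel_span K \<Longrightarrow> ip s u = 0"
  have "u x \<bullet> u x = 0" for x
    using orth[OF kernel_span.kernel_section, of x "u x"] K u by (simp add: reproducing_kernel_def)
  then show "u = (\<lambda>x. 0)" by auto
qed (use kernel_span_subset[OF K] v in \<open>auto intro: kernel_span.intros\<close>)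

text \<open>Evaluation is the inner product with a kernel section, so it inherits the continuity of
  \<open>ip\<close>.\<close>

lemma tendsto_eval:
  assumes K: "reproducing_kernel H ip K" and h: "\<And>n::nat. h n \<in> H" and f: "f \<in> H"
    and lim: "(\<lambda>n. ip_dist H ip (h n) f) \<longlonglongrightarrow> 0"
  shows "(\<lambda>n. \<alpha> \<bullet> h n x) \<longlonglongrightarrow> \<alpha> \<bullet> f x"
proof -
  let ?s = "\<lambda>y. K y x *v \<alpha>"
  have s: "?s \<in> H" and eval: "ip u ?s = \<alpha> \<bullet> u x" if "u \<in> H" for u
    using K that ip_commute unfolding reproducing_kernel_def by metis+
  show ?thesis using tendsto_ip_left[OF h f s[OF f] lim] by (simp add: eval h f)
qed

section \<open>Conjugation by an orthogonal matrix\<close>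

lemma conjugation_isometry:
  fixes R :: "real^'n^'n"
  assumes K: "reproducing_kernel H ip K" and R: "orthogonal_matrix R"
    and equiv: "\<And>x y. K (R *v x) (R *v y) = R ** K x y ** transpose R"
  shows "isometry_in H ip (\<lambda>v x. R *v v (transpose R *v x))"
proof -
  define T where "T v = (\<lambda>x. R *v v (transpose R *v x))" for v :: "real^'n \<Rightarrow> real^'n"
  note cancel = orthogonal_matrix_cancel[OF R]
  have T_add: "T (\<lambda>x. u x + v x) = (\<lambda>x. T u x + T v x)"
    and T_diff: "T (\<lambda>x. u x - v x) = (\<lambda>x. T u x - T v x)"
    and T_scale: "T (\<lambda>x. c *\<^sub>R u x) = (\<lambda>x. c *\<^sub>R T u x)" for u v c
    by (simp_all add: T_def matrix_vector_right_distrib matrix_vector_mult_diff_distrib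
        matrix_vector_mult_scaleR)
  have inner_T: "\<alpha> \<bullet> T v x = (transpose R *v \<alpha>) \<bullet> v (transpose R *v x)" for \<alpha> v x
    by (simp add: T_def inner_matrix_vector_mult)
  \<comment> \<open>The section at \<open>x\<close> in direction \<alpha> goes to the section at
    \<open>R *v x\<close> in direction \<open>R *v \<alpha>\<close>.\<close>
  have T_section: "T (\<lambda>y. K y x *v \<alpha>) = (\<lambda>y. K y (R *v x) *v (R *v \<alpha>))" for x \<alpha>
  proof
    fix y
    have "K y (R *v x) = R ** K (transpose R *v y) x ** transpose R"
      using equiv[of "transpose R *v y" x] by (simp add: cancel)
    then show "T (\<lambda>y. K y x *v \<alpha>) y = K y (R *v x) *v (R *v \<alpha>)"
      by (simp add: T_def cancel flip: matrix_vector_mul_assoc)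
  qed
  have span_H: "f \<in> H" if "f \<in> kernel_span K" for f using kernel_span_subset[OF K that] .
  have T_span: "T f \<in> kernel_span K" if "f \<in> kernel_span K" for f
    using that
    by induction (auto simp: T_section T_add T_scale intro: kernel_span.intros)
  \<comment> \<open>\<open>T g \<in> H\<close> is assumed here because invariance of
    \<open>H\<close> under \<open>T\<close> is proved only afterwards. Leaving \<open>g\<close>
    outside the span makes one induction suffice.\<close>
  have ip_T_span: "ip (T f) (T g) = ip f g" if "f \<in> kernel_span K" "g \<in> H" "T g \<in> H" for f g
    using that(1)
  proof induction
    case (kernel_section x \<alpha>)
    have "ip (T (\<lambda>y. K y x *v \<alpha>)) (T g) = (R *v \<alpha>) \<bullet> T g (R *v x)"
      using K that unfolding T_section reproducing_kernel_def by blast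
    also have "\<dots> = \<alpha> \<bullet> g x" by (simp add: inner_T cancel)
    also have "\<dots> = ip (\<lambda>y. K y x *v \<alpha>) g"
      using K that unfolding reproducing_kernel_def by simp
    finally show ?case .
  qed (use that span_H T_span in \<open>simp_all add: T_add T_scale ip_add_left ip_scale_left\<close>)
  \<comment> \<open>Since \<open>T\<close> preserves distances on the span, \<open>T (h n)\<close>
    is Cauchy. Its limit \<open>w\<close> is shown to be \<open>T v\<close>, which yields
    \<open>T v \<in> H\<close>.\<close>
  have approx: "\<exists>h. (\<forall>n. h n \<in> kernel_span K) \<and> (\<lambda>n::nat. ip_dist H ip (h n) v) \<longlonglongrightarrow> 0
      \<and> T v \<in> H \<and> (\<lambda>n. ip_dist H ip (T (h n)) (T v)) \<longlonglongrightarrow> 0" if v: "v \<in> H" for v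
  proof -
    obtain h where "(\<forall>n. h n \<in> kernel_span K) \<and> (\<lambda>n. ip_dist H ip (h n) v) \<longlonglongrightarrow> 0"
      using kernel_span_dense[OF K v] by (rule exE)
    then have hS: "\<And>n. h n \<in> kernel_span K" and lim: "(\<lambda>n. ip_dist H ip (h n) v) \<longlonglongrightarrow> 0"
      by simp_all
    have hH: "h n \<in> H" and ThH: "T (h n) \<in> H" for n
      using hS span_H T_span by auto
    have dist_T: "ip_dist H ip (T (h m)) (T (h n)) = ip_dist H ip (h m) (h n)" for m n
    proof -
      have "(\<lambda>x. h m x + (-1) *\<^sub>R h n x) \<in> kernel_span K"
        using hS by (intro kernel_span.intros)
      then have d: "(\<lambda>x. h m x - h n x) \<in> kernel_span K" by simp
      show ?thesis
        using ip_T_span[OF d span_H[OF d] span_H[OF T_span[OF d]]] hH ThH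
        by (simp add: ip_dist_def T_diff)
    qed
    interpret M: Metric_space H "ip_dist H ip" by (rule Metric_space_ip_dist)
    have "limitin M.mtopology h v sequentially"
      using lim v hH by (simp add: M.limitin_metric_dist_null)
    then have "M.MCauchy h"
      using hH by (intro M.convergent_imp_MCauchy) auto
    then have Cauchy: "\<exists>N. \<forall>m\<ge>N. \<forall>n\<ge>N. ip_dist H ip (T (h m)) (T (h n)) < e" if "e > 0" for e
      using that by (simp add: M.MCauchy_def dist_T)
    obtain w where w: "w \<in> H" and lim_w: "(\<lambda>n. ip_dist H ip (T (h n)) w) \<longlonglongrightarrow> 0"
      using ip_dist_Cauchy_convergent[of "\<lambda>n. T (h n)", OF ThH Cauchy] by metis
    \<comment> \<open>Testing \<open>T (h n)\<close> at \<open>x\<close> against \<alpha> is testing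
      \<open>h n\<close> at \<open>transpose R *v x\<close> against
      \<open>transpose R *v \<alpha>\<close>, so one real sequence has both limits.\<close>
    have "\<alpha> \<bullet> T v x = \<alpha> \<bullet> w x" for \<alpha> x
      using LIMSEQ_unique[OF tendsto_eval[OF K hH v lim, of "transpose R *v \<alpha>" "transpose R *v x"]]
        tendsto_eval[OF K ThH w lim_w, of \<alpha> x]
      by (simp add: inner_T)
    then have "T v = w" by (metis ext vector_eq_rdot inner_commute)
    then show ?thesis using hS lim w lim_w by (intro exI[of _ h]) simp
  qed
  then have T_H: "T v \<in> H" if "v \<in> H" for v using that by blast
  have "ip (T u) (T v) = ip u v" if u: "u \<in> H" and v: "v \<in> H" for u v
  proof -
    obtain h where h: "(\<forall>n. h n \<in> kernel_span K) \<and> (\<lambda>n::nat. ip_dist H ip (h n) u) \<longlonglongrightarrow> 0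
      \<and> T u \<in> H \<and> (\<lambda>n. ip_dist H ip (T (h n)) (T u)) \<longlonglongrightarrow> 0"
      using approx[OF u] by (rule exE)
    then have hS: "\<And>n. h n \<in> kernel_span K"
      and lim: "(\<lambda>n. ip_dist H ip (h n) u) \<longlonglongrightarrow> 0" "(\<lambda>n. ip_dist H ip (T (h n)) (T u)) \<longlonglongrightarrow> 0"
      by simp_all
    have hH: "h n \<in> H" for n using hS span_H by blast
    \<comment> \<open>Approximating \<open>u\<close> alone is enough, because
      \<open>ip_T_span\<close> accepts any \<open>v\<close> in \<open>H\<close> now that
      \<open>T_H\<close> is available.\<close>
    have "(\<lambda>n. ip (h n) v) \<longlonglongrightarrow> ip u v"
      using hH u v lim(1) by (rule tendsto_ip_left)
    moreover have "(\<lambda>n. ip (T (h n)) (T v)) \<longlonglongrightarrow> ip (T u) (T v)"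
      using T_H[OF hH] T_H[OF u] T_H[OF v] lim(2) by (rule tendsto_ip_left)
    ultimately show ?thesis
      using LIMSEQ_unique by (simp add: ip_T_span hS v T_H)
  qed
  then have "isometry_in H ip T" using T_H by (simp add: isometry_in_def)
  then show ?thesis by (simp add: T_def[abs_def])
qed

text \<open>Writing \<open>u\<close> as the conjugate of \<open>?w\<close> moves the inner product
  back to a section of \<open>K\<close>. Preserving \<open>ip\<close> does not by itself make a map
  onto \<open>H\<close>, so \<open>inv\<close> supplies this preimage.\<close>

lemma reproducing_kernel_conjugate:
  fixes R :: "real^'n^'n"
  assumes K: "reproducing_kernel H ip K" and R: "orthogonal_matrix R"
    and iso: "isometry_in H ip (\<lambda>v x. R *v v (transpose R *v x))"
    and inv: "\<And>u. u \<in> H \<Longrightarrow> (\<lambda>x. transpose R *v u (R *v x)) \<in> H"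
  shows "reproducing_kernel H ip (\<lambda>y x. R ** K (transpose R *v y) (transpose R *v x) ** transpose R)"
  unfolding reproducing_kernel_def
proof (intro allI conjI ballI)
  fix x \<alpha> :: "real^'n"
  note cancel = orthogonal_matrix_cancel[OF R]
  let ?f = "\<lambda>y. K y (transpose R *v x) *v (transpose R *v \<alpha>)"
  let ?g = "\<lambda>y. (R ** K (transpose R *v y) (transpose R *v x) ** transpose R) *v \<alpha>"
  have f: "?f \<in> H" using K by (simp add: reproducing_kernel_def)
  have g: "?g = (\<lambda>y. R *v ?f (transpose R *v y))"
    by (simp flip: matrix_vector_mul_assoc)
  show "?g \<in> H"
    unfolding g using isometry_inD(1)[OF iso f] .
  fix u assume u: "u \<in> H"
  let ?w = "\<lambda>x. transpose R *v u (R *v x)"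
  have w: "?w \<in> H" using inv[OF u] .
  have "(\<lambda>y. R *v ?w (transpose R *v y)) = u" by (simp add: cancel)
  then have "ip ?g u = ip (\<lambda>y. R *v ?f (transpose R *v y)) (\<lambda>y. R *v ?w (transpose R *v y))"
    by (simp add: g)
  also have "\<dots> = ip ?f ?w" using isometry_inD(2)[OF iso f w] .
  also have "\<dots> = (transpose R *v \<alpha>) \<bullet> ?w (transpose R *v x)"
    using K w unfolding reproducing_kernel_def by blast
  also have "\<dots> = (transpose R *v \<alpha>) \<bullet> (transpose R *v u x)" by (simp add: cancel)
  also have "\<dots> = \<alpha> \<bullet> u x"
    by (simp add: inner_matrix_vector_mult cancel)
  finally show "ip ?g u = \<alpha> \<bullet> u x" .
qed

end

section \<open>Equivariance of translation-invariant kernels\<close>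

theorem theorem3p5:
  fixes H :: "(real^'n \<Rightarrow> real^'n) set"
    and ip :: "(real^'n \<Rightarrow> real^'n) \<Rightarrow> (real^'n \<Rightarrow> real^'n) \<Rightarrow> real"
    and K :: "real^'n \<Rightarrow> real^'n \<Rightarrow> real^'n^'n"
    and k :: "real^'n \<Rightarrow> real^'n^'n"
  assumes "CARD('n) \<ge> 2"
    and "rkhs H ip"
    and "reproducing_kernel H ip K"
    and "\<forall>x y. K x y = k (x - y)"
  shows "(\<forall>R. orthogonal_matrix R \<longrightarrow> isometry_in H ip (\<lambda>v x. R *v v (matrix_inv R *v x)))
    \<longleftrightarrow> (\<forall>x R. orthogonal_matrix R \<longrightarrow> k (R *v x) = R ** k x ** matrix_inv R)"
proof (intro iffI allI impI)
  interpret rkhs H ip by fact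
  fix x and R :: "real^'n^'n"
  assume iso: "\<forall>R. orthogonal_matrix R \<longrightarrow> isometry_in H ip (\<lambda>v x. R *v v (matrix_inv R *v x))"
    and R: "orthogonal_matrix R"
  have Rt: "orthogonal_matrix (transpose R)" using R by (simp add: orthogonal_matrix_transpose)
  have iso_R: "isometry_in H ip (\<lambda>v x. R *v v (transpose R *v x))"
    using iso R by (metis matrix_inv_orthogonal)
  \<comment> \<open>Conjugation by the inverse matrix also maps \<open>H\<close> into
    \<open>H\<close>, which provides the preimages required by
    \<open>reproducing_kernel_conjugate\<close>.\<close>
  have "isometry_in H ip (\<lambda>v x. transpose R *v v (R *v x))"
    using iso Rt by (metis matrix_inv_orthogonal transpose_transpose)
  note isometry_inD(1)[OF this]
  note reproducing_kernel_conjugate[OF assms(3) R iso_R this]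
  then have "K = (\<lambda>y x. R ** K (transpose R *v y) (transpose R *v x) ** transpose R)"
    using reproducing_kernel_unique[OF inner_product_function_space_axioms assms(3)] by blast
  \<comment> \<open>With second argument \<open>0\<close>, which \<open>R\<close> fixes,
    \<open>K\<close> reduces to \<open>k\<close>.\<close>
  then have "K (R *v x) 0 = R ** K (transpose R *v (R *v x)) (transpose R *v 0) ** transpose R"
    by metis
  then show "k (R *v x) = R ** k x ** matrix_inv R"
    using assms(4) by (simp add: orthogonal_matrix_cancel[OF R] matrix_inv_orthogonal[OF R])
next
  interpret rkhs H ip by fact
  fix R :: "real^'n^'n"
  assume equiv: "\<forall>x R. orthogonal_matrix R \<longrightarrow> k (R *v x) = R ** k x ** matrix_inv R"
    and R: "orthogonal_matrix R"
  have "K (R *v x) (R *v y) = R ** K x y ** transpose R" for x y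
    using equiv R assms(4)
    by (simp add: matrix_inv_orthogonal flip: matrix_vector_mult_diff_distrib)
  from conjugation_isometry[OF assms(3) R this]
  show "isometry_in H ip (\<lambda>v x. R *v v (matrix_inv R *v x))"
    by (simp add: matrix_inv_orthogonal[OF R])
qed

end
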